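(* Let $A\in\mathbb{Q}^{r\times m}$ and $b_i\in\mathbb{Q}^r$ for $i\in N$, and let $X_i=\{x_i\in\mathbb{Z}^m: Ax_i\ge b_i\}$ be nonempty, $g_i(x_i)=x_i$, and $\pi_i(u,x_i)=\sum_{j\in E}\pi_j(u)x_{ij}$ with resource-specific functions $\pi_j:\mathbb{Z}^m\to\mathbb{R}$, $j\in E$ (homogeneous linear cost functions). Let $P_N=\{z\in\mathbb{R}^m: Az\ge\sum_{i\in N}b_i,\ z\ge0\}$ be the aggregation polytope, and assume that $P_N$ is box-TDI and satisfies the integer decomposition property (IDP). Then every $u\in\mathbb{Z}^m$ with $P_N\cap\{y\in\mathbb{R}^m:y\le u\}\ne\emptyset$ is weakly enforceable with market clearing prices for $G^{\min}(u)$. Moreover, under the same condition, every $u$ that is minimal with respect to $P_N$ is enforceable for $G^{\min}(u)$.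
   Context: Setting. $E=\{1,\dots,m\}$ (resources) and $N=\{1,\dots,n\}$ (players) are finite nonempty sets, $X=\prod_{i\in N}X_i$, and $\ell(x)=\sum_{i\in N}g_i(x_i)=\sum_{i\in N}x_i$. In the game $G^{\min}(u)$ player $i$ chooses $x_i\in X_i$ and has cost $\pi_i(u,x_i)$. It is assumed throughout that the master problem $\min\{\sum_{i\in N}\pi_i(u,x_i):\ell(x)\le u,\ x\in X\}$ has a global minimum. Enforceability. $u$ is enforceable if there is $(x^*,\lambda)\in X\times\mathbb{R}^m_+$ with $\ell(x^* )=u$ and (b) $x_i^*\in\arg\min_{x_i\in X_i}\{\pi_i(u,x_i)+\lambda^\intercal x_i\}$ for all $i\in N$. It is weakly enforceable with market clearing prices if there is $(x^*,\lambda)\in X\times\mathbb{R}^m_+$ such that (b) holds, $\ell(x^* )\le u$, and $\ell_j(x^* )<u_j\Rightarrow\lambda_j=0$ for all $j\in E$. Minimality. $u$ is minimal with respect to $P_N$ if there are strictly increasing functions $h_j:\mathbb{R}\to\mathbb{R}$ ($j\in E$) such that $u\in\arg\min_{u'\in\mathbb{R}^m}\{\sum_{j\in E}h_j(u'_j):\exists z\in P_N\text{ with }z\le u'\}$. Box-TDI. A rational system $Cz\ge d$ in $m$ variables is totally dual integral (TDI) if for every integral $c\in\mathbb{Z}^m$ the dual $\max\{y^\intercal d:C^\intercal y=c,\ y\ge0\}$ of $\min\{c^\intercal z:Cz\ge d\}$ has an integral optimal solution (if the problem admits a finite optimal solution). It is box-TDI if the system $Cz\ge d,\ w\le z\le v$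 is TDI for all rational $w,v$. A polytope is box-TDI if it can be described by a box-TDI system. IDP. $P_N$ satisfies the IDP if any integral optimal solution $z\in P_N$ (optimal for the linear program $\min\{\sum_{j\in E}\pi_j(u)y_j: y\in P_N,\ y\le u\}$) can be decomposed into feasible integral vectors, that is, $z=\sum_{i\in N}z_i$ with $z_i\in X_i$ for all $i\in N$.
   Formalization: Two hypotheses are added, without which the claim fails: every strategy set X_i consists of nonnegative vectors, and the aggregation polytope P_N is integral (the convex hull of its integral points). *)

theory Defs
  imports "HOL-Analysis.Analysis"
begin

text \<open>
  Resources are the elements of the finite type \<open>'m\<close>, players those of the finite type \<open>'n\<close>.
  Inequalities between vectors are componentwise. Integral and rational vectors are real vectors
  with components in \<open>\<int>\<close> resp. \<open>\<rat>\<close>.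
\<close>

definition int_vecs :: "(real ^ 'm) set" where
  "int_vecs = {x. \<forall>j. x $ j \<in> \<int>}"

definition rat_vecs :: "(real ^ 'm) set" where
  "rat_vecs = {x. \<forall>j. x $ j \<in> \<rat>}"


section \<open>The game and enforceability\<close>

text \<open>
  A game is given by strategy sets \<open>X i\<close> and costs \<open>cost i u x\<close>, the cost \<open>\<pi>\<^sub>i(u, x)\<close> of player \<open>i\<close>
  for playing \<open>x\<close> under the capacity vector \<open>u\<close>.
\<close>

definition load :: "('n::finite \<Rightarrow> real ^ 'm) \<Rightarrow> real ^ 'm" where
  "load x = (\<Sum>i\<in>UNIV. x i)"

definition master_has_min ::
  "('n::finite \<Rightarrow> (real ^ 'm) set) \<Rightarrow> ('n \<Rightarrow> real ^ 'm \<Rightarrow> real ^ 'm \<Rightarrow> real) \<Rightarrow> real ^ 'm \<Rightarrow> bool" where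
  "master_has_min X cost u \<longleftrightarrow>
     (\<exists>x. is_arg_min (\<lambda>x. \<Sum>i\<in>UNIV. cost i u (x i)) (\<lambda>x. (\<forall>i. x i \<in> X i) \<and> load x \<le> u) x)"

definition best_replies ::
  "('n::finite \<Rightarrow> (real ^ 'm) set) \<Rightarrow> ('n \<Rightarrow> real ^ 'm \<Rightarrow> real ^ 'm \<Rightarrow> real) \<Rightarrow> real ^ 'm
     \<Rightarrow> real ^ 'm \<Rightarrow> ('n \<Rightarrow> real ^ 'm) \<Rightarrow> bool" where
  "best_replies X cost u p x \<longleftrightarrow>
     (\<forall>i. is_arg_min (\<lambda>y. cost i u y + p \<bullet> y) (\<lambda>y. y \<in> X i) (x i))"

definition enforceable ::
  "('n::finite \<Rightarrow> (real ^ 'm) set) \<Rightarrow> ('n \<Rightarrow> real ^ 'm \<Rightarrow> real ^ 'm \<Rightarrow> real) \<Rightarrow> real ^ 'm \<Rightarrow> bool" where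
  "enforceable X cost u \<longleftrightarrow>
     (\<exists>x p. (\<forall>i. x i \<in> X i) \<and> 0 \<le> p \<and> load x = u \<and> best_replies X cost u p x)"

definition weakly_enforceable_market_clearing ::
  "('n::finite \<Rightarrow> (real ^ 'm) set) \<Rightarrow> ('n \<Rightarrow> real ^ 'm \<Rightarrow> real ^ 'm \<Rightarrow> real) \<Rightarrow> real ^ 'm \<Rightarrow> bool" where
  "weakly_enforceable_market_clearing X cost u \<longleftrightarrow>
     (\<exists>x p. (\<forall>i. x i \<in> X i) \<and> 0 \<le> p \<and> best_replies X cost u p x \<and> load x \<le> u \<and>
        (\<forall>j. load x $ j < u $ j \<longrightarrow> p $ j = 0))"

definition minimal_wrt :: "(real ^ 'm) set \<Rightarrow> real ^ 'm \<Rightarrow> bool" where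
  "minimal_wrt P u \<longleftrightarrow>
     (\<exists>h :: 'm \<Rightarrow> real \<Rightarrow> real. (\<forall>j. strict_mono (h j)) \<and>
        is_arg_min (\<lambda>u'. \<Sum>j\<in>UNIV. h j (u' $ j)) (\<lambda>u'. \<exists>z\<in>P. z \<le> u') u)"


section \<open>Box-total dual integrality\<close>

text \<open>
  A system \<open>C z \<ge> d\<close> is the finite set of its inequalities \<open>a \<bullet> z \<ge> \<beta>\<close>, each represented as the pair
  \<open>(a, \<beta>)\<close>, so that the number of rows can be quantified over. A dual vector \<open>y\<close> assigns a
  multiplier to each inequality. Repeating an inequality does not affect total dual integrality.
\<close>

definition rational_system :: "((real ^ 'm) \<times> real) set \<Rightarrow> bool" where
  "rational_system S \<longleftrightarrow> finite S \<and> (\<forall>(a, \<beta>)\<in>S. a \<in> rat_vecs \<and> \<beta> \<in> \<rat>)"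

definition solutions :: "((real ^ 'm) \<times> real) set \<Rightarrow> (real ^ 'm) set" where
  "solutions S = {z. \<forall>(a, \<beta>)\<in>S. a \<bullet> z \<ge> \<beta>}"

definition dual_feasible ::
  "((real ^ 'm) \<times> real) set \<Rightarrow> real ^ 'm \<Rightarrow> ((real ^ 'm) \<times> real \<Rightarrow> real) \<Rightarrow> bool" where
  "dual_feasible S c y \<longleftrightarrow> (\<forall>r\<in>S. 0 \<le> y r) \<and> (\<Sum>r\<in>S. y r *\<^sub>R fst r) = c"

definition dual_optimal ::
  "((real ^ 'm) \<times> real) set \<Rightarrow> real ^ 'm \<Rightarrow> ((real ^ 'm) \<times> real \<Rightarrow> real) \<Rightarrow> bool" where
  "dual_optimal S c y \<longleftrightarrow> is_arg_max (\<lambda>y. \<Sum>r\<in>S. y r * snd r) (dual_feasible S c) y"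

definition TDI :: "((real ^ 'm) \<times> real) set \<Rightarrow> bool" where
  "TDI S \<longleftrightarrow> rational_system S \<and>
     (\<forall>c\<in>int_vecs. (\<exists>y. dual_optimal S c y) \<longrightarrow>
        (\<exists>y. dual_optimal S c y \<and> (\<forall>r\<in>S. y r \<in> \<int>)))"

definition box_system :: "real ^ 'm \<Rightarrow> real ^ 'm \<Rightarrow> ((real ^ 'm) \<times> real) set" where
  "box_system w v = range (\<lambda>j. (axis j 1, w $ j)) \<union> range (\<lambda>j. (- axis j 1, - v $ j))"

definition box_TDI :: "((real ^ 'm) \<times> real) set \<Rightarrow> bool" where
  "box_TDI S \<longleftrightarrow> rational_system S \<and>
     (\<forall>w\<in>rat_vecs. \<forall>v\<in>rat_vecs. TDI (S \<union> box_system w v))"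

definition box_TDI_polyhedron :: "(real ^ 'm) set \<Rightarrow> bool" where
  "box_TDI_polyhedron P \<longleftrightarrow> (\<exists>S. box_TDI S \<and> P = solutions S)"

text \<open>
  Total dual integrality forces integral optimal solutions only for integral right-hand sides, and
  \<^const>\<open>box_TDI_polyhedron\<close> puts no such requirement on the describing system; integrality of a
  polyhedron is therefore a separate notion.
\<close>

definition integral_polyhedron :: "(real ^ 'm) set \<Rightarrow> bool" where
  "integral_polyhedron P \<longleftrightarrow> P = convex hull (P \<inter> int_vecs)"


section \<open>Integral polyhedral strategy sets with homogeneous linear costs\<close>

text \<open>
  Only the aggregation polytope carries the constraint \<open>z \<ge> 0\<close>; the strategy sets are nonnegative
  only if the system \<open>A x \<ge> b\<^sub>i\<close> makes them so.
\<close>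

definition strategies :: "real ^ 'm ^ 'r \<Rightarrow> ('n \<Rightarrow> real ^ 'r) \<Rightarrow> 'n \<Rightarrow> (real ^ 'm) set" where
  "strategies A b i = {x \<in> int_vecs. A *v x \<ge> b i}"

definition aggregation_polytope :: "real ^ 'm ^ 'r \<Rightarrow> ('n::finite \<Rightarrow> real ^ 'r) \<Rightarrow> (real ^ 'm) set" where
  "aggregation_polytope A b = {z. A *v z \<ge> (\<Sum>i\<in>UNIV. b i) \<and> z \<ge> 0}"

text \<open>
  The functions \<open>\<pi> j\<close> are total on real vectors, but are only ever used at integral capacities.
  The costs are homogeneous: they do not depend on the player.
\<close>

definition linear_cost :: "('m \<Rightarrow> real ^ 'm \<Rightarrow> real) \<Rightarrow> 'n \<Rightarrow> real ^ 'm \<Rightarrow> real ^ 'm \<Rightarrow> real" where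
  "linear_cost \<pi> i u x = (\<Sum>j\<in>UNIV. \<pi> j u * x $ j)"

definition IDP ::
  "('n::finite \<Rightarrow> (real ^ 'm) set) \<Rightarrow> (real ^ 'm) set \<Rightarrow> ('m \<Rightarrow> real ^ 'm \<Rightarrow> real) \<Rightarrow> real ^ 'm \<Rightarrow> bool" where
  "IDP X P \<pi> u \<longleftrightarrow>
     (\<forall>z\<in>int_vecs. is_arg_min (\<lambda>y. \<Sum>j\<in>UNIV. \<pi> j u * y $ j) (\<lambda>y. y \<in> P \<and> y \<le> u) z \<longrightarrow>
        (\<exists>x. (\<forall>i. x i \<in> X i) \<and> z = (\<Sum>i\<in>UNIV. x i)))"

end

theory Submission
  imports Defs
begin

text \<open>
  The price \<open>p\<close> consists of the dual multipliers of the capacity constraints \<open>y \<le> u\<close> in the linear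
  program that minimises \<open>\<pi>(u) \<bullet> y\<close> over \<open>P\<^sub>N\<close>: relaxing these constraints, an optimal \<open>z\<close> minimises
  \<open>\<pi>(u) + p\<close> over \<open>P\<^sub>N\<close>. If \<open>z\<close> is the sum of strategies, a profitable unilateral deviation would
  again sum to a point of \<open>P\<^sub>N\<close> and improve on \<open>z\<close>. So only an integral optimal \<open>z\<close> is needed.
  For integral \<open>c\<close>, integral dual multipliers of the boxed system split \<open>c\<close> into an integral
  combination of box rows and an integral \<open>c'\<close> whose minimum over the integral polyhedron \<open>P\<^sub>N\<close> is
  attained at the same point, hence is an integer; so the minimum of \<open>c\<close> over the boxed polyhedron
  is an integer as well. A vertex minimises both \<open>c\<close> and \<open>c + e\<^sub>j\<close> for some integral \<open>c\<close>, which makes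
  its \<open>j\<close>-th coordinate a difference of two integers.
\<close>

section \<open>Linear programming duality\<close>

text \<open>A finitely generated cone is closed, so a point \<open>c\<close> outside it is strictly
  separated from it. Because the cone contains 0 and is closed under scaling, the separating normal
  \<open>d\<close> is nonnegative on all generators but negative on \<open>c\<close>.\<close>

lemma farkas:
  fixes a :: "'i \<Rightarrow> 'v::euclidean_space"
  assumes "finite I"
    and nonneg: "\<And>d. (\<forall>i\<in>I. 0 \<le> a i \<bullet> d) \<Longrightarrow> 0 \<le> c \<bullet> d"
  shows "\<exists>y. (\<forall>i\<in>I. 0 \<le> y i) \<and> (\<Sum>i\<in>I. y i *\<^sub>R a i) = c"
proof -
  define K where "K = convex_cone hull (a ` I)"
  define T where "T = {v. \<exists>y. (\<forall>i\<in>I. 0 \<le> y i) \<and> (\<Sum>i\<in>I. y i *\<^sub>R a i) = v}"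
  have "c \<in> K"
  proof (rule ccontr)
    assume "c \<notin> K"
    moreover have "convex K" "closed K"
      using \<open>finite I\<close> by (auto simp: K_def convex_convex_cone_hull closed_convex_cone_hull)
    ultimately obtain d s where ds: "d \<bullet> c < s" "\<And>x. x \<in> K \<Longrightarrow> s < d \<bullet> x"
      using separating_hyperplane_closed_point[of K c] by auto
    have "s < 0"
      using ds(2)[of 0] by (simp add: K_def convex_cone_hull_contains_0)
    have "0 \<le> a i \<bullet> d" if "i \<in> I" for i
    proof (rule ccontr)
      assume neg: "\<not> 0 \<le> a i \<bullet> d"
      \<comment> \<open>The factor is chosen so that \<open>d\<close> takes exactly the value
        \<open>s\<close> on \<open>t *\<^sub>R a i\<close>, which the strict separation forbids on
        \<open>K\<close>.\<close>
      define t where "t = s / (a i \<bullet> d)"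
      have "0 \<le> t"
        unfolding t_def using neg \<open>s < 0\<close> by (simp add: divide_nonpos_neg)
      moreover have "a i \<in> K"
        unfolding K_def using that by (simp add: hull_inc)
      ultimately have "t *\<^sub>R a i \<in> K"
        unfolding K_def by (simp add: convex_cone_hull_mul)
      from ds(2)[OF this] show False
        using neg by (simp add: t_def inner_commute)
    qed
    then have "0 \<le> c \<bullet> d"
      using nonneg by blast
    then show False
      using ds(1) \<open>s < 0\<close> by (simp add: inner_commute)
  qed
  moreover have "K \<subseteq> T"
    unfolding K_def
  proof (rule hull_minimal)
    show "a ` I \<subseteq> T"
    proof
      fix v assume "v \<in> a ` I"
      then obtain k where k: "k \<in> I" "v = a k" by auto
      have "(\<Sum>i\<in>I. (if i = k then 1 else 0) *\<^sub>R a i) = v"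
        using k \<open>finite I\<close> by (simp add: if_distrib[of "\<lambda>t. t *\<^sub>R _"] cong: if_cong)
      then show "v \<in> T"
        unfolding T_def by (intro CollectI exI[of _ "\<lambda>i. if i = k then 1 else 0"]) auto
    qed
    show "convex_cone T"
      unfolding convex_cone_iff
    proof (intro conjI ballI allI impI)
      show "0 \<in> T"
        unfolding T_def by (intro CollectI exI[of _ "\<lambda>_. 0"]) auto
    next
      fix v w assume "v \<in> T" "w \<in> T"
      then obtain y y' where "\<forall>i\<in>I. 0 \<le> y i" "(\<Sum>i\<in>I. y i *\<^sub>R a i) = v"
        "\<forall>i\<in>I. 0 \<le> y' i" "(\<Sum>i\<in>I. y' i *\<^sub>R a i) = w"
        unfolding T_def by auto
      then show "v + w \<in> T"
        unfolding T_def
        by (intro CollectI exI[of _ "\<lambda>i. y i + y' i"]) (auto simp: scaleR_add_left sum.distrib)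
    next
      fix v and t :: real assume "v \<in> T" "0 \<le> t"
      then obtain y where "\<forall>i\<in>I. 0 \<le> y i" "(\<Sum>i\<in>I. y i *\<^sub>R a i) = v"
        unfolding T_def by auto
      then show "t *\<^sub>R v \<in> T"
        unfolding T_def using \<open>0 \<le> t\<close>
        by (intro CollectI exI[of _ "\<lambda>i. t * y i"]) (auto simp: scaleR_sum_right)
    qed
  qed
  ultimately show ?thesis
    unfolding T_def by blast
qed

text \<open>Tight rows do not decrease along \<open>d\<close>, and slack rows survive a small step
  by continuity; since there are finitely many rows, one step length serves them all.\<close>

lemma solutions_tight_direction:
  assumes "finite S" "z \<in> solutions S"
    and dir: "\<And>r. r \<in> S \<Longrightarrow> fst r \<bullet> z = snd r \<Longrightarrow> 0 \<le> fst r \<bullet> d"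
  shows "\<exists>t>0. z + t *\<^sub>R d \<in> solutions S"
proof -
  have "\<forall>\<^sub>F t in at_right (0::real). snd r \<le> fst r \<bullet> (z + t *\<^sub>R d)" if r: "r \<in> S" for r
  proof (cases "fst r \<bullet> z = snd r")
    case True
    have "\<forall>\<^sub>F t in at_right (0::real). 0 < t"
      by (rule eventually_at_right_less)
    then show ?thesis
      by eventually_elim (use True dir[OF r True] in \<open>simp add: inner_add_right\<close>)
  next
    case False
    then have less: "snd r < fst r \<bullet> z"
      using \<open>z \<in> solutions S\<close> r unfolding solutions_def by force
    have "((\<lambda>t. fst r \<bullet> (z + t *\<^sub>R d)) \<longlongrightarrow> fst r \<bullet> (z + 0 *\<^sub>R d)) (at_right 0)"
      by (intro tendsto_intros)
    then have "((\<lambda>t. fst r \<bullet> (z + t *\<^sub>R d)) \<longlongrightarrow> fst r \<bullet> z) (at_right 0)"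
      by simp
    from order_tendstoD(1)[OF this less] show ?thesis
      by eventually_elim simp
  qed
  then have "\<forall>\<^sub>F t in at_right (0::real). \<forall>r\<in>S. snd r \<le> fst r \<bullet> (z + t *\<^sub>R d)"
    using \<open>finite S\<close> by (simp add: eventually_ball_finite_distrib)
  then have "\<forall>\<^sub>F t in at_right (0::real). 0 < t \<and> z + t *\<^sub>R d \<in> solutions S"
    using eventually_at_right_less[of 0]
    by eventually_elim (auto simp: solutions_def)
  then show ?thesis
    using eventually_happens'[of "at_right (0::real)"] by force
qed

text \<open>Optimality of \<open>z\<close> says that no direction admissible for the tight rows
  lowers \<open>c\<close>, so Farkas writes \<open>c\<close> as a nonnegative combination of the
  tight rows. Multiplier 0 on the slack rows gives complementary slackness.\<close>

lemma complementary_dual_exists: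
  assumes "finite S" "z \<in> solutions S"
    and min: "\<And>z'. z' \<in> solutions S \<Longrightarrow> c \<bullet> z \<le> c \<bullet> z'"
  shows "\<exists>y. dual_feasible S c y \<and> (\<forall>r\<in>S. y r * (fst r \<bullet> z - snd r) = 0)"
proof -
  define I where "I = {r\<in>S. fst r \<bullet> z = snd r}"
  have "finite I" "I \<subseteq> S"
    using \<open>finite S\<close> by (auto simp: I_def)
  have "0 \<le> c \<bullet> d" if "\<forall>r\<in>I. 0 \<le> fst r \<bullet> d" for d
  proof -
    have "\<exists>t>0. z + t *\<^sub>R d \<in> solutions S"
      by (rule solutions_tight_direction[OF assms(1,2)]) (use that in \<open>simp add: I_def\<close>)
    then obtain t where "t > 0" "z + t *\<^sub>R d \<in> solutions S"
      by blast
    with min[of "z + t *\<^sub>R d"] show ?thesis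
      by (simp add: inner_add_right zero_le_mult_iff)
  qed
  from farkas[OF \<open>finite I\<close> this] obtain y where
    y: "\<forall>r\<in>I. 0 \<le> y r" "(\<Sum>r\<in>I. y r *\<^sub>R fst r) = c" by blast
  define y' where "y' r = (if r \<in> I then y r else 0)" for r
  have "(\<Sum>r\<in>S. y' r *\<^sub>R fst r) = (\<Sum>r\<in>I. y r *\<^sub>R fst r)"
    using \<open>finite S\<close> \<open>I \<subseteq> S\<close> by (intro sum.mono_neutral_cong_right) (auto simp: y'_def)
  then have "dual_feasible S c y'"
    using y by (auto simp: dual_feasible_def y'_def)
  then show ?thesis
    by (intro exI[of _ y']) (auto simp: y'_def I_def)
qed

section \<open>Duality gap and complementary slackness\<close>

lemma dual_value_eq_slack:
  assumes "dual_feasible S c y"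
  shows "c \<bullet> z - (\<Sum>r\<in>S. y r * snd r) = (\<Sum>r\<in>S. y r * (fst r \<bullet> z - snd r))"
proof -
  have "c = (\<Sum>r\<in>S. y r *\<^sub>R fst r)"
    using assms by (simp add: dual_feasible_def)
  then show ?thesis
    by (simp add: inner_sum_left right_diff_distrib sum_subtractf)
qed

lemma weak_duality:
  assumes "dual_feasible S c y" "z \<in> solutions S"
  shows "(\<Sum>r\<in>S. y r * snd r) \<le> c \<bullet> z"
proof -
  have "0 \<le> (\<Sum>r\<in>S. y r * (fst r \<bullet> z - snd r))"
    using assms by (intro sum_nonneg) (force simp: dual_feasible_def solutions_def)
  then show ?thesis
    using dual_value_eq_slack[OF assms(1), of z] by simp
qed

text \<open>A complementary dual vector closes the duality gap. This supplies the existence premise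
  in the definition of \<open>TDI\<close>.\<close>

lemma dual_optimal_exists:
  assumes "finite S" "z \<in> solutions S"
    and "\<And>z'. z' \<in> solutions S \<Longrightarrow> c \<bullet> z \<le> c \<bullet> z'"
  shows "\<exists>y. dual_optimal S c y"
proof -
  obtain y where y: "dual_feasible S c y" "\<forall>r\<in>S. y r * (fst r \<bullet> z - snd r) = 0"
    using complementary_dual_exists[OF assms] by blast
  have "(\<Sum>r\<in>S. y r * (fst r \<bullet> z - snd r)) = 0"
    using y(2) by (intro sum.neutral)
  then have "(\<Sum>r\<in>S. y r * snd r) = c \<bullet> z"
    using dual_value_eq_slack[OF y(1), of z] by simp
  then have "dual_optimal S c y"
    unfolding dual_optimal_def is_arg_max_def
    using y(1) weak_duality[OF _ \<open>z \<in> solutions S\<close>] by (auto simp: not_less)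
  then show ?thesis by blast
qed

text \<open>\<open>TDI\<close> yields some integral optimal dual vector, so complementarity is
  required of every optimal one. Its value reaches that of a complementary \<open>y0\<close>, so its
  slack terms, all nonnegative, sum to 0.\<close>

lemma dual_optimal_complementary:
  assumes "finite S" "z \<in> solutions S"
    and "\<And>z'. z' \<in> solutions S \<Longrightarrow> c \<bullet> z \<le> c \<bullet> z'"
    and opt: "dual_optimal S c y" and "r \<in> S"
  shows "y r * (fst r \<bullet> z - snd r) = 0"
proof -
  have feas: "dual_feasible S c y"
    using opt by (simp add: dual_optimal_def is_arg_max_def)
  obtain y0 where y0: "dual_feasible S c y0" "\<forall>r\<in>S. y0 r * (fst r \<bullet> z - snd r) = 0"
    using complementary_dual_exists[OF assms(1-3)] by blast
  have "(\<Sum>r\<in>S. y0 r * (fst r \<bullet> z - snd r)) = 0"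
    using y0(2) by (intro sum.neutral)
  then have "c \<bullet> z = (\<Sum>r\<in>S. y0 r * snd r)"
    using dual_value_eq_slack[OF y0(1), of z] by simp
  also have "\<dots> \<le> (\<Sum>r\<in>S. y r * snd r)"
    using opt y0(1) by (auto simp: dual_optimal_def is_arg_max_def not_less)
  finally have "(\<Sum>r\<in>S. y r * (fst r \<bullet> z - snd r)) \<le> 0"
    using dual_value_eq_slack[OF feas, of z] by simp
  moreover have nonneg: "0 \<le> y r * (fst r \<bullet> z - snd r)" if "r \<in> S" for r
    using that feas \<open>z \<in> solutions S\<close> by (force simp: dual_feasible_def solutions_def)
  ultimately have "(\<Sum>r\<in>S. y r * (fst r \<bullet> z - snd r)) = 0"
    using sum_nonneg[of S "\<lambda>r. y r * (fst r \<bullet> z - snd r)"] by (blast intro: order_antisym)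
  then show ?thesis
    using sum_nonneg_eq_0_iff[of S "\<lambda>r. y r * (fst r \<bullet> z - snd r)"] \<open>finite S\<close> nonneg
      \<open>r \<in> S\<close> by blast
qed

text \<open>Lagrangian relaxation: the rows of \<open>B\<close> are dropped and their multipliers
  charged to the objective. The remaining multipliers are still complementary to \<open>z\<close>
  and certify its optimality. It serves both for box rows and for capacity rows.\<close>

lemma relaxed_minimum:
  assumes "finite S" "finite B" "dual_feasible (S \<union> B) c y"
    and slack: "\<And>r. r \<in> S \<union> B \<Longrightarrow> y r * (fst r \<bullet> z - snd r) = 0"
    and "z' \<in> solutions S"
  shows "(c - (\<Sum>r\<in>B. y r *\<^sub>R fst r)) \<bullet> z \<le> (c - (\<Sum>r\<in>B. y r *\<^sub>R fst r)) \<bullet> z'"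
proof -
  \<comment> \<open>A row lying in both \<open>S\<close> and \<open>B\<close> is counted with
    \<open>B\<close> only.\<close>
  have "c = (\<Sum>r\<in>S - B. y r *\<^sub>R fst r) + (\<Sum>r\<in>B. y r *\<^sub>R fst r)"
    using assms(1-3) sum.subset_diff[of B "S \<union> B" "\<lambda>r. y r *\<^sub>R fst r"]
    by (simp add: dual_feasible_def Un_Diff)
  then have c': "c - (\<Sum>r\<in>B. y r *\<^sub>R fst r) = (\<Sum>r\<in>S - B. y r *\<^sub>R fst r)"
    by (simp add: algebra_simps)
  have "y r * (fst r \<bullet> z) \<le> y r * (fst r \<bullet> z')" if "r \<in> S - B" for r
  proof -
    have "y r * (fst r \<bullet> z) = y r * snd r"
      using slack[of r] that by (simp add: algebra_simps)
    moreover have "0 \<le> y r" "snd r \<le> fst r \<bullet> z'"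
      using that assms(3,5) by (force simp: dual_feasible_def solutions_def)+
    ultimately show ?thesis
      by (metis mult_left_mono)
  qed
  then show ?thesis
    unfolding c' by (auto simp: inner_sum_left intro: sum_mono)
qed

section \<open>Integrality of boxed polyhedra\<close>

lemma int_vecs_diff: "x \<in> int_vecs \<Longrightarrow> y \<in> int_vecs \<Longrightarrow> x - y \<in> int_vecs"
  by (simp add: int_vecs_def)

lemma int_vecs_sum: "(\<And>i. i \<in> I \<Longrightarrow> f i \<in> int_vecs) \<Longrightarrow> sum f I \<in> int_vecs"
  by (auto simp: int_vecs_def)

lemma inner_int_vecs: "x \<in> int_vecs \<Longrightarrow> y \<in> int_vecs \<Longrightarrow> x \<bullet> y \<in> \<int>"
  by (auto simp: int_vecs_def inner_vec_def)

lemma axis_int_vecs: "axis j 1 \<in> int_vecs"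
  by (simp add: int_vecs_def axis_def)

lemma finite_box_system: "finite (box_system w v)"
  by (simp add: box_system_def)

lemma solutions_Un: "solutions (S \<union> B) = solutions S \<inter> solutions B"
  by (auto simp: solutions_def)

lemma solutions_box_system: "solutions (box_system w v) = {w..v}"
proof -
  have "solutions (box_system w v) = 
    {z. (\<forall>j. w $ j \<le> axis j 1 \<bullet> z) \<and> (\<forall>j. - v $ j \<le> - axis j 1 \<bullet> z)}"
    by (simp add: solutions_def box_system_def ball_Un)
  also have "\<dots> = {w..v}"
    by (auto simp: less_eq_vec_def inner_axis')
  finally show ?thesis .
qed

text \<open>If the minimum were fractional, all integral points of \<open>P\<close> would lie in the
  open half-space above it, and so would their convex hull, which contains \<open>z\<close>.\<close>

lemma integral_polyhedron_min_value_int: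
  assumes "integral_polyhedron P" "c \<in> int_vecs" "z \<in> P"
    and min: "\<And>z'. z' \<in> P \<Longrightarrow> c \<bullet> z \<le> c \<bullet> z'"
  shows "c \<bullet> z \<in> \<int>"
proof (rule ccontr)
  assume "c \<bullet> z \<notin> \<int>"
  have "P = convex hull (P \<inter> int_vecs)"
    using assms(1) by (simp add: integral_polyhedron_def)
  also have "\<dots> \<subseteq> {x. c \<bullet> z < c \<bullet> x}"
  proof (rule hull_minimal)
    show "P \<inter> int_vecs \<subseteq> {x. c \<bullet> z < c \<bullet> x}"
      using min \<open>c \<bullet> z \<notin> \<int>\<close> inner_int_vecs[OF \<open>c \<in> int_vecs\<close>] by (force simp: less_le)
    show "convex {x. c \<bullet> z < c \<bullet> x}"
      using convex_halfspace_gt[of "c \<bullet> z" c] by simp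
  qed
  finally show False
    using \<open>z \<in> P\<close> by blast
qed

text \<open>Integral multipliers alone do not suffice, as \<open>S\<close> may have fractional
  right-hand sides. Only the box part is evaluated through its right-hand sides; the rest is left to
  the integrality of \<open>solutions S\<close>.\<close>

lemma TDI_box_min_value_int:
  assumes "finite S" "TDI (S \<union> box_system w v)" "integral_polyhedron (solutions S)"
    and "w \<in> int_vecs" "v \<in> int_vecs" "c \<in> int_vecs"
    and z: "z \<in> solutions (S \<union> box_system w v)"
    and min: "\<And>z'. z' \<in> solutions (S \<union> box_system w v) \<Longrightarrow> c \<bullet> z \<le> c \<bullet> z'"
  shows "c \<bullet> z \<in> \<int>"
proof -
  define B where "B = box_system w v"
  have "finite B"
    by (simp add: B_def finite_box_system)
  have row: "fst r \<in> int_vecs \<and> snd r \<in> \<int>" if "r \<in> B" for r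
    using that assms(4,5) by (auto simp: B_def box_system_def int_vecs_def axis_def)
  have fin: "finite (S \<union> B)"
    using \<open>finite S\<close> \<open>finite B\<close> by simp
  obtain y where y: "dual_optimal (S \<union> B) c y" "\<forall>r\<in>S \<union> B. y r \<in> \<int>"
    using assms(2,6) dual_optimal_exists[OF fin, of z c] z min unfolding TDI_def B_def by blast
  have slack: "y r * (fst r \<bullet> z - snd r) = 0" if "r \<in> S \<union> B" for r
    using dual_optimal_complementary[OF fin, of z c y] z min y(1) that by (simp add: B_def)
  define c' where "c' = c - (\<Sum>r\<in>B. y r *\<^sub>R fst r)"
  have "c' \<in> int_vecs"
    unfolding c'_def using row y(2) \<open>c \<in> int_vecs\<close>
    by (intro int_vecs_diff int_vecs_sum) (auto simp: int_vecs_def)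
  moreover have "c' \<bullet> z \<le> c' \<bullet> z'" if "z' \<in> solutions S" for z'
    unfolding c'_def using y(1) that
    by (intro relaxed_minimum[OF \<open>finite S\<close> \<open>finite B\<close> _ slack])
      (auto simp: dual_optimal_def is_arg_max_def)
  ultimately have "c' \<bullet> z \<in> \<int>"
    using integral_polyhedron_min_value_int[OF assms(3)] z by (auto simp: solutions_Un)
  \<comment> \<open>By complementary slackness, every box row with nonzero multiplier is tight at
    \<open>z\<close>.\<close>
  moreover have "(\<Sum>r\<in>B. y r *\<^sub>R fst r) \<bullet> z = (\<Sum>r\<in>B. y r * snd r)"
    unfolding inner_sum_left using slack by (intro sum.cong) (auto simp: algebra_simps)
  moreover have "(\<Sum>r\<in>B. y r * snd r) \<in> \<int>"
    using row y(2) by (auto intro!: Ints_sum Ints_mult)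
  moreover have "c \<bullet> z = c' \<bullet> z + (\<Sum>r\<in>B. y r *\<^sub>R fst r) \<bullet> z"
    by (simp add: c'_def inner_diff_left)
  ultimately show ?thesis
    by simp
qed

section \<open>Integrality of vertices\<close>

text \<open>A vertex of a polytope is exposed, so the costs that single it out form a nonempty open
  cone. Far out, this cone contains balls large enough to hold an integral vector together with all
  its translates by unit vectors.\<close>

lemma polytope_vertex_integral_cost:
  fixes Q :: "(real ^ 'm) set"
  assumes "polytope Q" "z extreme_point_of Q"
  shows "\<exists>c\<in>int_vecs. \<forall>x\<in>Q. c \<bullet> z \<le> c \<bullet> x \<and> (\<forall>j. (c + axis j 1) \<bullet> z \<le> (c + axis j 1) \<bullet> x)"
proof -
  obtain V where V: "finite V" "Q = convex hull V"
    using \<open>polytope Q\<close> by (auto simp: polytope_def)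
  have "{z} exposed_face_of Q"
    using assms by (simp add: exposed_face_of_polyhedron face_of_singleton polytope_imp_polyhedron)
  then obtain a \<beta> where a: "Q \<subseteq> {x. a \<bullet> x \<le> \<beta>}" "{z} = Q \<inter> {x. a \<bullet> x = \<beta>}"
    unfolding exposed_face_of_def by blast
  \<comment> \<open>The costs under which every other generator in \<open>V\<close> is strictly
    worse than \<open>z\<close>. The exposing functional \<open>a\<close> is maximal at
    \<open>z\<close>, so \<open>- a\<close> is the cost in \<open>C\<close>.\<close>
  define C where "C = (\<Inter>v\<in>V - {z}. {c. 0 < (v - z) \<bullet> c})"
  have "open C"
    unfolding C_def using \<open>finite V\<close> by (intro open_INT) (auto intro: open_halfspace_gt)
  moreover have "- a \<in> C"
  proof -
    have "a \<bullet> v < a \<bullet> z" if "v \<in> V - {z}" for v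
    proof -
      have "v \<in> Q" "v \<noteq> z"
        using that V(2) by (auto simp: hull_inc)
      then have "a \<bullet> v \<le> \<beta>" "a \<bullet> v \<noteq> \<beta>"
        using a by blast+
      moreover have "a \<bullet> z = \<beta>"
        using a by blast
      ultimately show ?thesis
        by simp
    qed
    then show ?thesis
      by (auto simp: C_def inner_diff_left inner_commute[of a])
  qed
  ultimately obtain e where e: "e > 0" "ball (- a) e \<subseteq> C"
    using openE by blast
  \<comment> \<open>\<open>C\<close> is an open cone, so around a large multiple of \<open>- a\<close> it contains all points within distance \<open>m\<close>.\<close>
  define m where "m = real CARD('m) + 1"
  define M where "M = (m + 1) / e"
  have "M > 0" "M * e = m + 1"
    using \<open>e > 0\<close> by (auto simp: M_def m_def)
  have near: "c \<in> C" if "norm (c + M *\<^sub>R a) \<le> m" for c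
  proof -
    have "dist (- a) ((1 / M) *\<^sub>R c) = norm ((1 / M) *\<^sub>R (c + M *\<^sub>R a))"
      using \<open>M > 0\<close> by (simp add: dist_norm norm_minus_commute[of "- a"] scaleR_add_right)
    also have "\<dots> \<le> m / M"
      using that \<open>M > 0\<close> by (simp add: divide_right_mono)
    also have "\<dots> < e"
      using \<open>M > 0\<close> \<open>M * e = m + 1\<close> by (simp add: pos_divide_less_eq mult.commute)
    finally have "(1 / M) *\<^sub>R c \<in> C"
      using e(2) by auto
    then show ?thesis
      using \<open>M > 0\<close> by (auto simp: C_def zero_less_divide_iff)
  qed
  have min: "c \<bullet> z \<le> c \<bullet> x" if "c \<in> C" "x \<in> Q" for c x
  proof -
    have "c \<bullet> z \<le> c \<bullet> v" if "v \<in> V" for v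
    proof (cases "v = z")
      case False
      then have "0 < (v - z) \<bullet> c"
        using \<open>c \<in> C\<close> that by (auto simp: C_def)
      then show ?thesis
        by (simp add: inner_diff_left inner_commute[of c])
    qed simp
    then have "Q \<subseteq> {x. c \<bullet> z \<le> c \<bullet> x}"
      unfolding V(2) by (intro hull_minimal convex_halfspace_ge) auto
    then show ?thesis
      using \<open>x \<in> Q\<close> by blast
  qed
  \<comment> \<open>Rounding moves each coordinate of \<open>- M *\<^sub>R a\<close> by at most 1,
    hence the vector by at most \<open>m - 1\<close>; the unit left over in \<open>m\<close> pays
    for adding \<open>axis j 1\<close>.\<close>
  define c :: "real ^ 'm" where "c = (\<chi> j. of_int \<lfloor>- M * a $ j\<rfloor>)"
  have "norm (c + M *\<^sub>R a) \<le> (\<Sum>j\<in>UNIV. \<bar>(c + M *\<^sub>R a) $ j\<bar>)"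
    by (rule norm_le_l1_cart)
  also have "\<dots> \<le> (\<Sum>j\<in>(UNIV::'m set). 1)"
    unfolding c_def by (intro sum_mono) (simp, linarith)
  finally have norm_c: "norm (c + M *\<^sub>R a) \<le> m - 1"
    by (simp add: m_def)
  then have "c \<in> C"
    by (intro near) simp
  moreover have "c + axis j 1 \<in> C" for j
  proof (rule near)
    have "norm (c + axis j 1 + M *\<^sub>R a) \<le> norm (c + M *\<^sub>R a) + norm (axis j (1::real))"
      using norm_triangle_ineq[of "c + M *\<^sub>R a" "axis j 1"] by (simp add: algebra_simps)
    then show "norm (c + axis j 1 + M *\<^sub>R a) \<le> m"
      using norm_c by (simp add: norm_axis_1)
  qed
  moreover have "c \<in> int_vecs"
    by (simp add: c_def int_vecs_def)
  ultimately show ?thesis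
    using min by blast
qed

lemma extreme_point_int_vecs:
  assumes "polytope Q" "z extreme_point_of Q"
    and val: "\<And>c z. c \<in> int_vecs \<Longrightarrow> z \<in> Q \<Longrightarrow> (\<And>x. x \<in> Q \<Longrightarrow> c \<bullet> z \<le> c \<bullet> x) \<Longrightarrow> c \<bullet> z \<in> \<int>"
  shows "z \<in> int_vecs"
proof -
  obtain c where c: "c \<in> int_vecs" "\<And>x. x \<in> Q \<Longrightarrow> c \<bullet> z \<le> c \<bullet> x"
    "\<And>x j. x \<in> Q \<Longrightarrow> (c + axis j 1) \<bullet> z \<le> (c + axis j 1) \<bullet> x"
    using polytope_vertex_integral_cost[OF assms(1,2)] by blast
  have "z \<in> Q"
    using assms(2) by (simp add: extreme_point_of_def)
  have "z $ j \<in> \<int>" for j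
  proof -
    have "c + axis j 1 \<in> int_vecs"
      using c(1) axis_int_vecs[of j] by (simp add: int_vecs_def)
    then have "(c + axis j 1) \<bullet> z \<in> \<int>"
      using val \<open>z \<in> Q\<close> c(3) by blast
    moreover have "c \<bullet> z \<in> \<int>"
      using val \<open>z \<in> Q\<close> c(1,2) by blast
    moreover have "z $ j = (c + axis j 1) \<bullet> z - c \<bullet> z"
      by (simp add: inner_add_left inner_axis')
    ultimately show ?thesis
      by simp
  qed
  then show ?thesis
    by (simp add: int_vecs_def)
qed

lemma polyhedron_solutions: "finite S \<Longrightarrow> polyhedron (solutions S)"
proof -
  assume "finite S"
  have "solutions S = (\<Inter>r\<in>S. {z. snd r \<le> fst r \<bullet> z})"
    by (auto simp: solutions_def case_prod_unfold)
  then show ?thesis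
    using \<open>finite S\<close> by (auto intro!: polyhedron_Inter polyhedron_halfspace_ge)
qed

text \<open>The minimisers form a nonempty compact face; it has an extreme point, and extreme points
  of a face are extreme in \<open>Q\<close>.\<close>

lemma polytope_extreme_minimizer:
  fixes Q :: "'v::euclidean_space set"
  assumes "polytope Q" "Q \<noteq> {}"
  shows "\<exists>z. z extreme_point_of Q \<and> (\<forall>x\<in>Q. c \<bullet> z \<le> c \<bullet> x)"
proof -
  have Q: "compact Q" "convex Q"
    using \<open>polytope Q\<close> by (auto simp: polytope_imp_compact polytope_imp_convex)
  have "continuous_on Q (\<lambda>x. c \<bullet> x)"
    by (intro continuous_intros)
  then obtain z0 where z0: "z0 \<in> Q" "\<And>x. x \<in> Q \<Longrightarrow> c \<bullet> z0 \<le> c \<bullet> x"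
    using continuous_attains_inf[OF Q(1) \<open>Q \<noteq> {}\<close>] by metis
  define F where "F = Q \<inter> {x. c \<bullet> x = c \<bullet> z0}"
  have face: "F face_of Q"
    unfolding F_def using z0(2) by (intro face_of_Int_supporting_hyperplane_ge Q(2)) auto
  have "compact F" "convex F" "F \<noteq> {}"
    using face_of_imp_compact[OF Q(2) Q(1) face] face_of_imp_convex[OF face] z0(1)
    by (auto simp: F_def)
  then obtain z where "z extreme_point_of F"
    using extreme_point_exists_convex by blast
  then have "z extreme_point_of Q" "z \<in> F"
    using extreme_point_of_face[OF face] by auto
  then show ?thesis
    using z0(2) by (auto simp: F_def)
qed

text \<open>Total dual integrality speaks about integral costs, while \<open>c\<close> is an
  arbitrary real vector. Passing through vertices bridges this: integral costs show all vertices of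
  the boxed polyhedron integral, and some vertex minimises \<open>c\<close>.\<close>

lemma box_TDI_integral_minimizer:
  assumes "box_TDI_polyhedron P" "integral_polyhedron P"
    and "w \<in> int_vecs" "v \<in> int_vecs" "P \<inter> {w..v} \<noteq> {}"
  shows "\<exists>z\<in>int_vecs. z \<in> P \<inter> {w..v} \<and> (\<forall>x\<in>P \<inter> {w..v}. c \<bullet> z \<le> c \<bullet> x)"
proof -
  obtain S where S: "box_TDI S" "P = solutions S"
    using assms(1) by (auto simp: box_TDI_polyhedron_def)
  have "finite S"
    using S(1) by (simp add: box_TDI_def rational_system_def)
  have "w \<in> rat_vecs" "v \<in> rat_vecs"
    using assms(3,4) Ints_subset_Rats by (auto simp: int_vecs_def rat_vecs_def)
  then have tdi: "TDI (S \<union> box_system w v)"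
    using S(1) by (simp add: box_TDI_def)
  have sol: "solutions (S \<union> box_system w v) = P \<inter> {w..v}"
    by (simp add: S(2) solutions_Un solutions_box_system)
  have "polytope (P \<inter> {w..v})"
    unfolding S(2) interval_cbox_cart
    by (simp add: polyhedron_Int_polytope polyhedron_solutions \<open>finite S\<close> polytope_interval)
  moreover obtain z where z: "z extreme_point_of P \<inter> {w..v}" "\<forall>x\<in>P \<inter> {w..v}. c \<bullet> z \<le> c \<bullet> x"
    using polytope_extreme_minimizer[OF calculation assms(5)] by blast
  ultimately have "z \<in> int_vecs"
    using TDI_box_min_value_int[OF \<open>finite S\<close> tdi _ assms(3,4)] assms(2)
    by (intro extreme_point_int_vecs[of "P \<inter> {w..v}"])
      (auto simp: S(2) solutions_Un solutions_box_system)
  then show ?thesis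
    using z by (auto simp: extreme_point_of_def)
qed

section \<open>Prices\<close>

text \<open>The prices are dual multipliers of the capacity rows, market clearing is complementary
  slackness for these rows, and relaxing them turns the cost \<open>c\<close> into
  \<open>c + p\<close>.\<close>

lemma capacity_prices:
  fixes u :: "real ^ 'm"
  assumes "finite S" "z \<in> solutions S" "z \<le> u"
    and min: "\<And>x. x \<in> solutions S \<Longrightarrow> x \<le> u \<Longrightarrow> c \<bullet> z \<le> c \<bullet> x"
  shows "\<exists>p\<ge>0. (\<forall>j. z $ j < u $ j \<longrightarrow> p $ j = 0) \<and>
    (\<forall>x\<in>solutions S. (c + p) \<bullet> z \<le> (c + p) \<bullet> x)"
proof -
  \<comment> \<open>The capacity bound is negated to fit the \<open>\<ge>\<close> form of systems;
    hence the multipliers enter the relaxed cost with a plus sign.\<close>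
  define row where "row j = (- axis j 1 :: real ^ 'm, - u $ j)" for j
  define B where "B = range row"
  \<comment> \<open>Distinct resources give distinct rows, so the sum over \<open>B\<close> can be
    reindexed by resources.\<close>
  have "inj row"
    by (auto simp: row_def inj_def axis_eq_axis)
  have "finite B"
    by (simp add: B_def)
  have solB: "solutions B = {x. x \<le> u}"
    by (auto simp: solutions_def B_def row_def less_eq_vec_def inner_axis')
  have zU: "z \<in> solutions (S \<union> B)"
    using assms(2,3) by (simp add: solutions_Un solB)
  obtain y where y: "dual_feasible (S \<union> B) c y" "\<forall>r\<in>S \<union> B. y r * (fst r \<bullet> z - snd r) = 0"
    using complementary_dual_exists[of "S \<union> B" z c] \<open>finite S\<close> \<open>finite B\<close> zU min
    by (auto simp: solutions_Un solB)
  define p :: "real ^ 'm" where "p = (\<chi> j. y (row j))"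
  have "(\<Sum>r\<in>B. y r *\<^sub>R fst r) = (\<Sum>j\<in>UNIV. y (row j) *\<^sub>R (- axis j 1))"
    unfolding B_def by (subst sum.reindex[OF \<open>inj row\<close>]) (simp add: row_def)
  also have "\<dots> = - p"
    by (simp add: vec_eq_iff p_def axis_def if_distrib sum_negf sum.delta cong: if_cong)
  finally have cp: "c - (\<Sum>r\<in>B. y r *\<^sub>R fst r) = c + p"
    by simp
  have "(c + p) \<bullet> z \<le> (c + p) \<bullet> x" if "x \<in> solutions S" for x
    using relaxed_minimum[OF \<open>finite S\<close> \<open>finite B\<close> y(1) _ that, of z] y(2) by (simp add: cp)
  moreover have "0 \<le> p"
    using y(1) by (auto simp: dual_feasible_def less_eq_vec_def p_def B_def)
  moreover have "p $ j = 0" if "z $ j < u $ j" for j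
  proof -
    have "row j \<in> B"
      by (simp add: B_def)
    then have "y (row j) * (fst (row j) \<bullet> z - snd (row j)) = 0"
      using y(2) by blast
    then show ?thesis
      using that by (simp add: p_def row_def inner_axis')
  qed
  ultimately show ?thesis
    by blast
qed

section \<open>From optimal loads to best replies\<close>

lemma load_fun_upd: "load (x(i := y)) = load x - x i + y"
proof -
  have "load (x(i := y)) = (\<Sum>k\<in>UNIV - {i}. x k) + y"
    unfolding load_def by (subst sum.remove[of _ i]) auto
  moreover have "load x = (\<Sum>k\<in>UNIV - {i}. x k) + x i"
    unfolding load_def by (subst sum.remove[of _ i]) auto
  ultimately show ?thesis
    by simp
qed

text \<open>All players share the linear cost \<open>c\<close>, so a unilateral deviation changes
  the cost \<open>c + p\<close> of the load by exactly the change in the deviator's own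
  cost.\<close>

lemma best_replies_of_min_load:
  assumes cost: "\<And>i x. cost i u x = c \<bullet> x"
    and "\<And>i. x i \<in> X i"
    and min: "\<And>x'. (\<And>i. x' i \<in> X i) \<Longrightarrow> (c + p) \<bullet> load x \<le> (c + p) \<bullet> load x'"
  shows "best_replies X cost u p x"
  unfolding best_replies_def is_arg_min_def not_ex
proof (intro allI conjI notI)
  fix i
  show "x i \<in> X i" by fact
  fix y assume y: "y \<in> X i \<and> cost i u y + p \<bullet> y < cost i u (x i) + p \<bullet> x i"
  then have "(c + p) \<bullet> load x \<le> (c + p) \<bullet> load (x(i := y))"
    using assms(2) by (intro min) simp
  then show False
    using y by (simp add: cost load_fun_upd inner_add_left inner_add_right inner_diff_right)
qed

lemma load_strategies_in_aggregation:
  assumes "\<And>i. x i \<in> strategies A b i" "\<And>i. 0 \<le> x i"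
  shows "load x \<in> aggregation_polytope A b"
proof -
  have "A *v load x = (\<Sum>i\<in>UNIV. A *v x i)"
    by (simp add: load_def linear_sum[OF matrix_vector_mul_linear])
  moreover have "(\<Sum>i\<in>UNIV. b i) \<le> (\<Sum>i\<in>UNIV. A *v x i)"
    using assms(1) by (intro sum_mono) (simp add: strategies_def)
  moreover have "0 \<le> load x"
    unfolding load_def using assms(2) by (intro sum_nonneg) auto
  ultimately show ?thesis
    by (simp add: aggregation_polytope_def)
qed

text \<open>The point \<open>z\<close> is itself an admissible capacity vector. Were it below
  \<open>u\<close> in some coordinate, the strictly increasing \<open>h j\<close> would give it a
  smaller objective value than \<open>u\<close>.\<close>

lemma minimal_wrt_le_eq:
  fixes u z :: "real ^ 'm"
  assumes "minimal_wrt P u" "z \<in> P" "z \<le> u"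
  shows "z = u"
proof (rule ccontr)
  assume "z \<noteq> u"
  then obtain j where j: "z $ j < u $ j"
    using \<open>z \<le> u\<close> by (auto simp: vec_eq_iff less_eq_vec_def less_le)
  obtain h :: "'m \<Rightarrow> real \<Rightarrow> real" where h: "\<And>j. strict_mono (h j)"
    and min: "\<And>u'. \<exists>z\<in>P. z \<le> u' \<Longrightarrow> (\<Sum>j\<in>UNIV. h j (u $ j)) \<le> (\<Sum>j\<in>UNIV. h j (u' $ j))"
    using assms(1) unfolding minimal_wrt_def is_arg_min_def not_ex by (auto simp: not_less)
  have "(\<Sum>j\<in>UNIV. h j (z $ j)) < (\<Sum>j\<in>UNIV. h j (u $ j))"
    using h j \<open>z \<le> u\<close>
    by (intro sum_strict_mono_ex1)
      (auto simp: less_eq_vec_def strict_mono_less strict_mono_less_eq)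
  then show False
    using min[of z] \<open>z \<in> P\<close> by auto
qed

theorem theorem4p1:
  fixes A :: "real ^ 'm ^ 'r"
    and b :: "'n::finite \<Rightarrow> real ^ 'r"
    and \<pi> :: "'m \<Rightarrow> real ^ 'm \<Rightarrow> real"
    and u :: "real ^ 'm"
  assumes "\<And>k. A $ k \<in> rat_vecs"
    and "\<And>i. b i \<in> rat_vecs"
    and "\<And>i. strategies A b i \<noteq> {}"
    and "\<And>i x. x \<in> strategies A b i \<Longrightarrow> 0 \<le> x"
    and "integral_polyhedron (aggregation_polytope A b)"
    and "box_TDI_polyhedron (aggregation_polytope A b)"
    and "u \<in> int_vecs"
    and "IDP (strategies A b) (aggregation_polytope A b) \<pi> u"
    and "master_has_min (strategies A b) (linear_cost \<pi>) u"
    and "aggregation_polytope A b \<inter> {y. y \<le> u} \<noteq> {}"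
  shows "weakly_enforceable_market_clearing (strategies A b) (linear_cost \<pi>) u \<and>
    (minimal_wrt (aggregation_polytope A b) u \<longrightarrow>
       enforceable (strategies A b) (linear_cost \<pi>) u)"
proof -
  note sol_nonneg = assms(4) and integral = assms(5) and boxTDI = assms(6)
    and u = assms(7) and idp = assms(8) and nonempty = assms(10)
  define P where "P = aggregation_polytope A b"
  define c :: "real ^ 'm" where "c = (\<chi> j. \<pi> j u)"
  have cost: "(\<Sum>j\<in>UNIV. \<pi> j u * x $ j) = c \<bullet> x" for x
    by (simp add: c_def inner_vec_def)
  \<comment> \<open>Since \<open>P\<close> is nonnegative, the capacity constraint cuts out the same
    set as a box with integral corners, to which box-TDI applies.\<close>
  have boxP: "P \<inter> {0..u} = {x \<in> P. x \<le> u}"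
    by (auto simp: P_def aggregation_polytope_def)
  have load_P: "load x \<in> P" if "\<And>i. x i \<in> strategies A b i" for x
    unfolding P_def using that sol_nonneg by (intro load_strategies_in_aggregation) auto
  have "\<exists>z\<in>int_vecs. z \<in> P \<inter> {0..u} \<and> (\<forall>x\<in>P \<inter> {0..u}. c \<bullet> z \<le> c \<bullet> x)"
    using boxTDI integral u nonempty unfolding P_def[symmetric]
    by (intro box_TDI_integral_minimizer) (auto simp: boxP int_vecs_def)
  then obtain z where z: "z \<in> int_vecs" "z \<in> P" "z \<le> u" "\<And>x. x \<in> P \<Longrightarrow> x \<le> u \<Longrightarrow> c \<bullet> z \<le> c \<bullet> x"
    unfolding boxP by blast
  have "is_arg_min (\<lambda>y. \<Sum>j\<in>UNIV. \<pi> j u * y $ j) (\<lambda>y. y \<in> P \<and> y \<le> u) z"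
    unfolding cost is_arg_min_def using z(2-4) by (auto simp: not_less)
  then have "\<exists>x. (\<forall>i. x i \<in> strategies A b i) \<and> z = (\<Sum>i\<in>UNIV. x i)"
    using idp z(1) unfolding IDP_def P_def[symmetric] by blast
  then obtain x where x: "\<And>i. x i \<in> strategies A b i" "load x = z"
    unfolding load_def by blast
  obtain S where S: "finite S" "P = solutions S"
    using boxTDI unfolding P_def[symmetric] box_TDI_polyhedron_def box_TDI_def rational_system_def
    by blast
  \<comment> \<open>Here only the upper bounds \<open>u\<close> join \<open>S\<close>: the lower
    bound 0 of the box already holds on \<open>P\<close>, so \<open>z\<close> stays optimal and only
    capacities are priced.\<close>
  obtain p where p: "0 \<le> p" "\<forall>j. z $ j < u $ j \<longrightarrow> p $ j = 0"
    "\<And>x. x \<in> P \<Longrightarrow> (c + p) \<bullet> z \<le> (c + p) \<bullet> x"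
    using capacity_prices[OF S(1), of z u c] z(2-4) unfolding S(2) by blast
  have br: "best_replies (strategies A b) (linear_cost \<pi>) u p x"
    using x p(3) load_P
    by (intro best_replies_of_min_load[where c = c]) (auto simp: linear_cost_def cost)
  have "weakly_enforceable_market_clearing (strategies A b) (linear_cost \<pi>) u"
    unfolding weakly_enforceable_market_clearing_def using x p(1,2) br z(3) by blast
  \<comment> \<open>Minimality of \<open>u\<close> forces \<open>z = u\<close>, so the same profile
    and prices exhaust the capacities exactly.\<close>
  moreover have "enforceable (strategies A b) (linear_cost \<pi>) u" if "minimal_wrt P u"
    unfolding enforceable_def using x p(1) br minimal_wrt_le_eq[OF that z(2,3)] by blast
  ultimately show ?thesis
    by (simp add: P_def)
qed

end
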